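(* In the graceful game on the path $P_n$: Bob has a winning strategy for every $n\geq 4$ (whoever starts); for $n=3$ the player who starts the game has a winning strategy; and Alice has a winning strategy for $n\in\{1,2\}$ (whoever starts).
   Context: $P_n$ denotes the path on $n$ vertices. A graceful labeling of a graph $G$ with $m$ edges is an injective map $f\colon V(G)\to\{0,1,\dots,m\}$ such that the induced edge labels $|f(u)-f(v)|$, $uv\in E(G)$, are pairwise distinct. The graceful game on a simple graph $G$ with $m$ edges: two players, Alice and Bob, alternately choose a free (not yet labeled) vertex and assign to it a label from $\{0,1,\dots,m\}$ not yet used. An edge both of whose endpoints are labeled gets label $|f(u)-f(v)|$; a move is legal only if after it all edge labels are pairwise distinct. Alice wins if the whole graph ends up gracefully labeled; Bob wins if he can prevent this. Either player may be the first to move. *)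

theory Defs
  imports Main
begin

text \<open>A simple graph is given by its vertex set \<open>V\<close> and its edge set \<open>E\<close>, each edge being the
  two-element set of its end vertices.\<close>

definition path_verts :: "nat \<Rightarrow> nat set" where
  "path_verts n = {..<n}"

definition path_edges :: "nat \<Rightarrow> nat set set" where
  "path_edges n = {{i, Suc i} | i. Suc i < n}"

lemma path_edges_simple: "e \<in> path_edges n \<Longrightarrow> e \<subseteq> path_verts n \<and> card e = 2"
  by (auto simp: path_edges_def path_verts_def)

lemma card_path_edges: "card (path_edges n) = n - 1"
proof -
  have "path_edges n = (\<lambda>i. {i, Suc i}) ` {..<n - 1}"
    by (auto simp: path_edges_def)
  moreover have "inj_on (\<lambda>i::nat. {i, Suc i}) {..<n - 1}"
    by (auto simp: inj_on_def doubleton_eq_iff)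
  ultimately show ?thesis
    by (simp add: card_image)
qed

definition graceful_labeling :: "'a set \<Rightarrow> 'a set set \<Rightarrow> ('a \<Rightarrow> nat) \<Rightarrow> bool" where
  "graceful_labeling V E f \<longleftrightarrow>
     inj_on f V \<and> f ` V \<subseteq> {0..card E} \<and>
     (\<forall>u v x y. {u, v} \<in> E \<and> {x, y} \<in> E \<and> {u, v} \<noteq> {x, y} \<longrightarrow>
        \<bar>int (f u) - int (f v)\<bar> \<noteq> \<bar>int (f x) - int (f y)\<bar>)"

datatype player = Alice | Bob

fun opponent :: "player \<Rightarrow> player" where
  "opponent Alice = Bob"
| "opponent Bob = Alice"

text \<open>A move is a vertex with the label assigned to it, and a history is the list of the moves made
  so far, in chronological order. Vertices in a history of legal moves are distinct, so
  \<open>map_of h\<close> is the partial labeling reached after \<open>h\<close>.\<close>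

type_synonym 'a move = "'a \<times> nat"

definition edge_labels_distinct :: "'a set set \<Rightarrow> ('a \<rightharpoonup> nat) \<Rightarrow> bool" where
  "edge_labels_distinct E f \<longleftrightarrow>
     (\<forall>u v x y a b c d. {u, v} \<in> E \<and> {x, y} \<in> E \<and> {u, v} \<noteq> {x, y} \<and>
        f u = Some a \<and> f v = Some b \<and> f x = Some c \<and> f y = Some d \<longrightarrow>
        \<bar>int a - int b\<bar> \<noteq> \<bar>int c - int d\<bar>)"

definition legal_move :: "'a set \<Rightarrow> 'a set set \<Rightarrow> 'a move list \<Rightarrow> 'a move \<Rightarrow> bool" where
  "legal_move V E h mv \<longleftrightarrow> (case mv of (v, l) \<Rightarrow>
     v \<in> V \<and> v \<notin> dom (map_of h) \<and>
     l \<in> {0..card E} \<and> l \<notin> ran (map_of h) \<and>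
     edge_labels_distinct E ((map_of h)(v \<mapsto> l)))"

definition legal_play :: "'a set \<Rightarrow> 'a set set \<Rightarrow> 'a move list \<Rightarrow> bool" where
  "legal_play V E h \<longleftrightarrow> (\<forall>i < length h. legal_move V E (take i h) (h ! i))"

definition complete_play :: "'a set \<Rightarrow> 'a set set \<Rightarrow> 'a move list \<Rightarrow> bool" where
  "complete_play V E h \<longleftrightarrow> legal_play V E h \<and> (\<nexists>mv. legal_move V E h mv)"

definition to_move :: "player \<Rightarrow> 'a move list \<Rightarrow> player" where
  "to_move starter h = (if even (length h) then starter else opponent starter)"

definition winner :: "'a set \<Rightarrow> 'a set set \<Rightarrow> 'a move list \<Rightarrow> player" where
  "winner V E h =
     (if dom (map_of h) = V \<and> graceful_labeling V E (the \<circ> map_of h) then Alice else Bob)"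

definition follows_strategy ::
    "player \<Rightarrow> player \<Rightarrow> ('a move list \<Rightarrow> 'a move) \<Rightarrow> 'a move list \<Rightarrow> bool" where
  "follows_strategy starter p \<sigma> h \<longleftrightarrow>
     (\<forall>i < length h. to_move starter (take i h) = p \<longrightarrow> h ! i = \<sigma> (take i h))"

text \<open>The first conjunct of the next definition makes a strategy always answer with a legal move if
  there is one. Without it, a strategy proposing illegal moves would have no complete play following
  it and would win vacuously.\<close>

definition winning_strategy ::
    "'a set \<Rightarrow> 'a set set \<Rightarrow> player \<Rightarrow> player \<Rightarrow> ('a move list \<Rightarrow> 'a move) \<Rightarrow> bool" where
  "winning_strategy V E starter p \<sigma> \<longleftrightarrow>
     (\<forall>h. legal_play V E h \<and> to_move starter h = p \<and> (\<exists>mv. legal_move V E h mv) \<longrightarrow>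
        legal_move V E h (\<sigma> h)) \<and>
     (\<forall>h. complete_play V E h \<and> follows_strategy starter p \<sigma> h \<longrightarrow> winner V E h = p)"

definition has_winning_strategy :: "'a set \<Rightarrow> 'a set set \<Rightarrow> player \<Rightarrow> player \<Rightarrow> bool" where
  "has_winning_strategy V E starter p \<longleftrightarrow> (\<exists>\<sigma>. winning_strategy V E starter p \<sigma>)"

end

theory Submission
  imports Defs
begin

text \<open>Let \<open>m = n - 1\<close>. A graceful labeling of \<open>P\<^sub>n\<close> realizes every difference \<open>1, \<dots>, m\<close>. The
  difference \<open>m\<close> forces \<open>0\<close> and \<open>m\<close> to be adjacent, and the difference \<open>m - 1\<close> forces \<open>1\<close> next to \<open>m\<close>
  or \<open>m - 1\<close> next to \<open>0\<close>. Hence, once \<open>0\<close> sits at an end vertex, the next two vertices must get \<open>m\<close>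
  and \<open>1\<close>. Bob puts \<open>0\<close> at an end vertex, away from Alice's first move if there was one. If Alice
  puts \<open>m\<close> next to it, Bob puts \<open>1\<close> at a wrong vertex, and otherwise he puts \<open>m\<close> at a wrong vertex;
  from then on no graceful labeling can be completed, and Bob wins whatever happens. An opening
  \<open>0\<close> or \<open>m\<close> of Alice is met at once by the other of the two at a nonadjacent vertex.\<close>

section \<open>Backward induction\<close>

text \<open>Positions from which \<open>p\<close> can force a win, as a least fixed point. The last
  premise of \<open>wins_other\<close> covers an opponent without a legal move: there the premise on
  successors is vacuous and the finished play has to be judged by \<open>winner\<close>.\<close>

inductive wins :: "'a set \<Rightarrow> 'a set set \<Rightarrow> player \<Rightarrow> player \<Rightarrow> 'a move list \<Rightarrow> bool"
  for V E starter p where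
  wins_end: "\<nexists>mv. legal_move V E h mv \<Longrightarrow> winner V E h = p \<Longrightarrow> wins V E starter p h"
| wins_own: "to_move starter h = p \<Longrightarrow> legal_move V E h mv \<Longrightarrow> wins V E starter p (h @ [mv]) \<Longrightarrow>
    wins V E starter p h"
| wins_other: "to_move starter h \<noteq> p \<Longrightarrow>
    (\<And>mv. legal_move V E h mv \<Longrightarrow> wins V E starter p (h @ [mv])) \<Longrightarrow>
    (\<nexists>mv. legal_move V E h mv \<Longrightarrow> winner V E h = p) \<Longrightarrow> wins V E starter p h"

text \<open>The strategy moves to a position in \<open>wins\<close> whenever one is reachable. Every
  prefix of a play that follows it then stays in \<open>wins\<close>, and a position in
  \<open>wins\<close> without legal moves is won by \<open>p\<close>.\<close>

lemma has_winning_strategy_if_wins: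
  assumes "wins V E starter p []"
  shows "has_winning_strategy V E starter p"
proof -
  \<comment> \<open>The second branch serves the first conjunct of \<open>winning_strategy\<close>,
    which asks for a legal answer even in plays that have left the strategy.\<close>
  define \<sigma> where "\<sigma> h = (if \<exists>mv. legal_move V E h mv \<and> wins V E starter p (h @ [mv])
      then SOME mv. legal_move V E h mv \<and> wins V E starter p (h @ [mv])
      else SOME mv. legal_move V E h mv)" for h
  have legal: "legal_move V E h (\<sigma> h)" if "\<exists>mv. legal_move V E h mv" for h
  proof (cases "\<exists>mv. legal_move V E h mv \<and> wins V E starter p (h @ [mv])")
    case True
    then have "\<sigma> h = (SOME mv. legal_move V E h mv \<and> wins V E starter p (h @ [mv]))"
      unfolding \<sigma>_def by (rule if_P)
    then show ?thesis using someI_ex[OF True] by simp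
  next
    case False
    then have "\<sigma> h = (SOME mv. legal_move V E h mv)" unfolding \<sigma>_def by (rule if_not_P)
    then show ?thesis using someI_ex[OF that] by simp
  qed
  have own: "wins V E starter p (h @ [\<sigma> h])"
    if "\<exists>mv. legal_move V E h mv \<and> wins V E starter p (h @ [mv])" for h
  proof -
    have "\<sigma> h = (SOME mv. legal_move V E h mv \<and> wins V E starter p (h @ [mv]))"
      using that unfolding \<sigma>_def by (rule if_P)
    then show ?thesis using someI_ex[OF that] by simp
  qed
  have "winner V E h = p" if "complete_play V E h" and follows: "follows_strategy starter p \<sigma> h" for h
  proof -
    have play: "legal_play V E h" and stuck: "\<nexists>mv. legal_move V E h mv"
      using that by (auto simp: complete_play_def)
    have "wins V E starter p (take i h)" if "i \<le> length h" for i
      using that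
    proof (induction i)
      case 0
      then show ?case using assms by simp
    next
      case (Suc i)
      then have i: "i < length h" and IH: "wins V E starter p (take i h)" by auto
      have step: "take (Suc i) h = take i h @ [h ! i]" using i by (simp add: take_Suc_conv_app_nth)
      have mv: "legal_move V E (take i h) (h ! i)" using play i by (simp add: legal_play_def)
      from IH show ?case
      proof cases
        case wins_end
        then show ?thesis using mv by blast
      next
        \<comment> \<open>The strategy need not choose \<open>mv'\<close>; the existence of
          \<open>mv'\<close> is enough for its choice to lie in \<open>wins\<close>.\<close>
        case (wins_own mv')
        then have "h ! i = \<sigma> (take i h)" using follows i by (simp add: follows_strategy_def)
        then show ?thesis using own wins_own step by metis
      next
        case wins_other
        then show ?thesis using mv step by simp
      qed
    qed
    from this[of "length h"] have "wins V E starter p h" by simp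
    then show ?thesis by cases (use stuck in blast)+
  qed
  with legal show ?thesis
    unfolding has_winning_strategy_def winning_strategy_def by blast
qed

lemma legal_move_fresh: "legal_move V E h (v, l) \<Longrightarrow> v \<in> V \<and> v \<notin> fst ` set h"
  by (auto simp: legal_move_def dom_map_of_conv_image_fst)

text \<open>The number of unlabeled vertices is the measure for the inductions over positions
  below.\<close>

lemma card_free_less:
  assumes "finite V" "legal_move V E h mv"
  shows "card (V - fst ` set (h @ [mv])) < card (V - fst ` set h)"
  using assms by (cases mv) (auto intro!: psubset_card_mono dest!: legal_move_fresh)

section \<open>Positions without a graceful completion\<close>

text \<open>The moves are read as constraints on a total labeling rather than through
  \<open>map_of\<close>, so that appending a move only adds a constraint and doom is visibly
  permanent.\<close>

definition doomed :: "'a set \<Rightarrow> 'a set set \<Rightarrow> 'a move list \<Rightarrow> bool" where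
  "doomed V E h \<longleftrightarrow> \<not> (\<exists>g. graceful_labeling V E g \<and> (\<forall>(v, l)\<in>set h. g v = l))"

text \<open>Doom survives every move of either player, and the final labeling of a doomed play is
  not graceful. Distinctness of the vertices makes \<open>map_of h\<close> agree with every move in
  \<open>h\<close>.\<close>

lemma wins_Bob_if_doomed:
  assumes "finite V" "distinct (map fst h)" "doomed V E h"
  shows "wins V E starter Bob h"
  using assms(2,3)
proof (induction "card (V - fst ` set h)" arbitrary: h rule: less_induct)
  case less
  have stuck: "winner V E h = Bob"
  proof -
    have "\<forall>(v, l)\<in>set h. (the \<circ> map_of h) v = l" using less.prems(1) by auto
    then have "\<not> graceful_labeling V E (the \<circ> map_of h)" using less.prems(2) unfolding doomed_def by blast
    then show ?thesis by (simp add: winner_def)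
  qed
  have step: "wins V E starter Bob (h @ [mv])" if mv: "legal_move V E h mv" for mv
  proof (rule less.hyps)
    show "card (V - fst ` set (h @ [mv])) < card (V - fst ` set h)"
      using card_free_less[OF assms(1) mv] .
    show "distinct (map fst (h @ [mv]))"
      using less.prems(1) mv legal_move_fresh[of V E h "fst mv" "snd mv"] by auto
    show "doomed V E (h @ [mv])" using less.prems(2) by (auto simp: doomed_def)
  qed
  show ?case
    using stuck step by (metis wins_end wins_own wins_other)
qed

section \<open>Legal plays, and positions where nobody can get stuck\<close>

lemma legal_play_snoc:
  "legal_play V E (h @ [mv]) \<longleftrightarrow> legal_play V E h \<and> legal_move V E h mv"
  by (auto simp: legal_play_def nth_append less_Suc_eq)

lemma legal_play_Nil [simp]: "legal_play V E []"
  by (simp add: legal_play_def)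

lemma legal_play_invariant:
  assumes "legal_play V E h"
  shows "distinct (map fst h) \<and> inj_on (map_of h) (dom (map_of h)) \<and> dom (map_of h) \<subseteq> V \<and>
    ran (map_of h) \<subseteq> {0..card E} \<and> edge_labels_distinct E (map_of h)"
  using assms
proof (induction h rule: rev_induct)
  case Nil
  then show ?case by (simp add: edge_labels_distinct_def)
next
  case (snoc mv h)
  obtain v l where mv: "mv = (v, l)" by fastforce
  have IH: "distinct (map fst h)" "inj_on (map_of h) (dom (map_of h))" "dom (map_of h) \<subseteq> V"
    "ran (map_of h) \<subseteq> {0..card E}" and legal: "legal_move V E h (v, l)"
    using snoc mv by (auto simp: legal_play_snoc)
  have v: "v \<notin> dom (map_of h)" "v \<in> V" "l \<le> card E" "l \<notin> ran (map_of h)"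
    "edge_labels_distinct E ((map_of h)(v \<mapsto> l))"
    using legal by (auto simp: legal_move_def)
  \<comment> \<open>\<open>map_of\<close> prefers earlier entries; the appended one takes effect
    because \<open>v\<close> is fresh.\<close>
  have eq: "map_of (h @ [mv]) = (map_of h)(v \<mapsto> l)"
    using v(1) mv by (auto simp: map_add_def fun_eq_iff split: option.splits)
  have inj: "inj_on ((map_of h)(v \<mapsto> l)) (insert v (dom (map_of h)))"
    using IH(2) v(1,4) by (auto simp: inj_on_def ran_def)
  have "ran ((map_of h)(v \<mapsto> l)) \<subseteq> {0..card E}"
    using IH(4) v(1,3) by (auto simp: ran_def)
  moreover have "distinct (map fst (h @ [mv]))"
    using IH(1) v(1) mv by (simp add: dom_map_of_conv_image_fst)
  ultimately show ?case
    unfolding eq using inj IH(3) v(2,5) by (simp del: fun_upd_apply)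
qed

text \<open>On a full domain the invariant of legal plays is gracefulness itself. Alice can
  therefore lose only by the play getting stuck early.\<close>

lemma winner_Alice_if_full:
  assumes "legal_play V E h" "dom (map_of h) = V" "\<Union>E \<subseteq> V"
  shows "winner V E h = Alice"
proof -
  let ?f = "map_of h"
  have inv: "inj_on ?f (dom ?f)" "ran ?f \<subseteq> {0..card E}" "edge_labels_distinct E ?f"
    using legal_play_invariant[OF assms(1)] by auto
  have val: "?f v = Some (the (?f v))" if "v \<in> V" for v
    using that assms(2) by auto
  have "inj_on (the \<circ> ?f) V"
  proof (rule inj_onI)
    fix x y
    assume "x \<in> V" "y \<in> V" "(the \<circ> ?f) x = (the \<circ> ?f) y"
    then have "?f x = ?f y" using val[of x] val[of y] by simp
    then show "x = y" using inv(1) assms(2) \<open>x \<in> V\<close> \<open>y \<in> V\<close> by (simp add: inj_on_def)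
  qed
  moreover have "(the \<circ> ?f) ` V \<subseteq> {0..card E}"
  proof
    fix l assume "l \<in> (the \<circ> ?f) ` V"
    then have "l \<in> ran ?f" using val by (auto intro: ranI)
    then show "l \<in> {0..card E}" using inv(2) by blast
  qed
  moreover have "\<bar>int ((the \<circ> ?f) u) - int ((the \<circ> ?f) v)\<bar> \<noteq> \<bar>int ((the \<circ> ?f) x) - int ((the \<circ> ?f) y)\<bar>"
    if "{u, v} \<in> E" "{x, y} \<in> E" "{u, v} \<noteq> {x, y}" for u v x y
  proof -
    have "u \<in> V" "v \<in> V" "x \<in> V" "y \<in> V" using that assms(3) by auto
    then show ?thesis
      using inv(3) that val unfolding edge_labels_distinct_def comp_apply by blast
  qed
  ultimately show ?thesis
    using assms(2) by (auto simp: winner_def graceful_labeling_def)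
qed

text \<open>The assumption ranges over all continuations \<open>t\<close>, so it passes to
  \<open>h @ [mv]\<close> via \<open>mv # t\<close>. It holds no matter who moves, so neither player
  needs a particular choice.\<close>

lemma wins_Alice_if_always_movable:
  assumes "finite V" "\<Union>E \<subseteq> V" "legal_play V E h"
    and "\<And>t. legal_play V E (h @ t) \<Longrightarrow> dom (map_of (h @ t)) \<noteq> V \<Longrightarrow> \<exists>mv. legal_move V E (h @ t) mv"
  shows "wins V E starter Alice h"
  using assms(3,4)
proof (induction "card (V - fst ` set h)" arbitrary: h rule: less_induct)
  case less
  have step: "wins V E starter Alice (h @ [mv])" if mv: "legal_move V E h mv" for mv
  proof (rule less.hyps)
    show "card (V - fst ` set (h @ [mv])) < card (V - fst ` set h)"
      using card_free_less[OF assms(1) mv] .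
    show "legal_play V E (h @ [mv])" using less.prems(1) mv by (simp add: legal_play_snoc)
    show "\<exists>mv'. legal_move V E ((h @ [mv]) @ t) mv'"
      if "legal_play V E ((h @ [mv]) @ t)" "dom (map_of ((h @ [mv]) @ t)) \<noteq> V" for t
      using less.prems(2)[of "mv # t"] that by simp
  qed
  have stuck: "winner V E h = Alice" if "\<nexists>mv. legal_move V E h mv"
    using less.prems(2)[of "[]"] less.prems(1) that winner_Alice_if_full[OF less.prems(1) _ assms(2)]
    by fastforce
  show ?case
    using stuck step by (metis wins_end wins_own wins_other)
qed

text \<open>Pigeonhole: at most as many labels are used as vertices are labeled, which is fewer than
  \<open>card V\<close> and hence fewer than the \<open>Suc (card E)\<close> available
  labels.\<close>

lemma ex_free_vertex_and_label:
  assumes "finite V" "card V \<le> Suc (card E)" "legal_play V E h" "dom (map_of h) \<noteq> V"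
  shows "\<exists>v l. v \<in> V \<and> v \<notin> dom (map_of h) \<and> l \<in> {0..card E} \<and> l \<notin> ran (map_of h)"
proof -
  let ?f = "map_of h"
  have dom: "dom ?f \<subset> V" using legal_play_invariant[OF assms(3)] assms(4) by auto
  have "ran ?f = (the \<circ> ?f) ` dom ?f" by (force simp: ran_def dom_def)
  then have "card (ran ?f) \<le> card (dom ?f)" by (simp add: card_image_le finite_dom_map_of)
  also have "\<dots> < card V" using dom assms(1) by (rule psubset_card_mono[rotated])
  also have "\<dots> \<le> card {0..card E}" using assms(2) by simp
  finally have "\<not> {0..card E} \<subseteq> ran ?f"
    using card_mono[of "ran ?f" "{0..card E}"] by (auto simp: finite_ran finite_dom_map_of)
  with dom show ?thesis by blast
qed

section \<open>Symmetry of the game\<close>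

lemma map_of_map_involution:
  assumes "\<And>v. \<rho> (\<rho> v) = v"
  shows "map_of (map (map_prod \<rho> id) h) = map_of h \<circ> \<rho>"
  using assms by (induction h) (auto simp: fun_eq_iff)

text \<open>Legality, the winner and the turn are all preserved by an automorphism of the graph, so
  a derivation of \<open>wins\<close> can be transported rule by rule. An involution is its own
  inverse, which lets each preservation result serve in both directions.\<close>

lemma wins_automorphism:
  fixes \<rho> :: "'a \<Rightarrow> 'a"
  assumes inv: "\<And>v. \<rho> (\<rho> v) = v" and V: "\<And>v. v \<in> V \<Longrightarrow> \<rho> v \<in> V"
    and E: "\<And>u v. {u, v} \<in> E \<Longrightarrow> {\<rho> u, \<rho> v} \<in> E"
    and "wins V E starter p h"
  shows "wins V E starter p (map (map_prod \<rho> id) h)"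
proof -
  let ?\<phi> = "map (map_prod \<rho> id) :: 'a move list \<Rightarrow> 'a move list"
  have eq: "\<rho> u = \<rho> v \<longleftrightarrow> u = v" for u v using inv by metis
  have E_iff: "{\<rho> u, \<rho> v} \<in> E \<longleftrightarrow> {u, v} \<in> E" for u v using E inv by metis
  have V_iff: "\<rho> v \<in> V \<longleftrightarrow> v \<in> V" for v using V inv by metis
  have edges: "edge_labels_distinct E (f \<circ> \<rho>)" if "edge_labels_distinct E f" for f
    unfolding edge_labels_distinct_def
  proof (intro allI impI, elim conjE)
    fix u v x y a b c d
    assume "{u, v} \<in> E" "{x, y} \<in> E" "{u, v} \<noteq> {x, y}" "(f \<circ> \<rho>) u = Some a" "(f \<circ> \<rho>) v = Some b"
      "(f \<circ> \<rho>) x = Some c" "(f \<circ> \<rho>) y = Some d"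
    moreover from this have "{\<rho> u, \<rho> v} \<noteq> {\<rho> x, \<rho> y}" by (auto simp: doubleton_eq_iff eq)
    ultimately show "\<bar>int a - int b\<bar> \<noteq> \<bar>int c - int d\<bar>"
      using that E_iff unfolding edge_labels_distinct_def comp_apply by blast
  qed
  have legal: "legal_move V E (?\<phi> h) (map_prod \<rho> id mv)" if "legal_move V E h mv" for h mv
  proof -
    obtain v l where mv: "mv = (v, l)" by fastforce
    have upd: "(map_of h \<circ> \<rho>)(\<rho> v \<mapsto> l) = (map_of h)(v \<mapsto> l) \<circ> \<rho>"
      using inv by (auto simp: fun_eq_iff)
    have ran: "ran (map_of h \<circ> \<rho>) = ran (map_of h)"
      using inv by (auto simp: ran_def) metis
    show ?thesis
      using that edges[of "(map_of h)(v \<mapsto> l)"] inv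
      by (auto simp: mv legal_move_def map_of_map_involution upd ran V_iff simp del: fun_upd_apply)
  qed
  have twice: "?\<phi> (?\<phi> h) = h" for h
    by (induction h) (auto simp: inv)
  have twice1: "map_prod \<rho> id (map_prod \<rho> id mv) = mv" for mv :: "'a move"
    by (cases mv) (simp add: inv)
  have legal': "legal_move V E h (map_prod \<rho> id mv)" if "legal_move V E (?\<phi> h) mv" for h mv
    using legal[OF that] twice by simp
  have stuck: "(\<nexists>mv. legal_move V E (?\<phi> h) mv) \<longleftrightarrow> (\<nexists>mv. legal_move V E h mv)" for h
    using legal legal' by blast
  have graceful: "graceful_labeling V E (g \<circ> \<rho>)" if "graceful_labeling V E g" for g
    unfolding graceful_labeling_def
  proof (intro conjI allI impI, goal_cases)
    case 1
    have "inj_on g (\<rho> ` V)"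
      using that V by (auto simp: graceful_labeling_def intro: inj_on_subset)
    moreover have "inj_on \<rho> V" using eq by (simp add: inj_on_def)
    ultimately show ?case by (simp add: comp_inj_on)
  next
    case 2
    show ?case using that V by (auto simp: graceful_labeling_def)
  next
    case (3 u v x y)
    then have "{\<rho> u, \<rho> v} \<noteq> {\<rho> x, \<rho> y}" by (auto simp: doubleton_eq_iff eq)
    moreover have "{\<rho> u, \<rho> v} \<in> E" "{\<rho> x, \<rho> y} \<in> E" using 3 E by auto
    ultimately show ?case
      using that unfolding graceful_labeling_def comp_apply by blast
  qed
  have dom: "dom (map_of h \<circ> \<rho>) = V \<longleftrightarrow> dom (map_of h) = V" for h :: "'a move list"
    unfolding dom_def set_eq_iff mem_Collect_eq comp_apply using inv V_iff by metis
  have "graceful_labeling V E (the \<circ> (map_of h \<circ> \<rho>)) \<longleftrightarrow> graceful_labeling V E (the \<circ> map_of h)" for h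
  proof -
    have "(the \<circ> (map_of h \<circ> \<rho>)) \<circ> \<rho> = the \<circ> map_of h" using inv by (simp add: fun_eq_iff)
    then show ?thesis
      using graceful[of "the \<circ> map_of h"] graceful[of "the \<circ> (map_of h \<circ> \<rho>)"] by (auto simp: comp_assoc)
  qed
  then have winner: "winner V E (?\<phi> h) = winner V E h" for h
    by (simp add: winner_def map_of_map_involution[OF inv] dom)
  have to_move: "to_move starter (?\<phi> h) = to_move starter h" for h
    by (simp add: to_move_def)
  from assms(4) show ?thesis
  proof induction
    case (wins_end h)
    show ?case
    proof (rule wins.wins_end)
      show "\<nexists>mv. legal_move V E (?\<phi> h) mv" using wins_end(1) stuck by blast
      show "winner V E (?\<phi> h) = p" using wins_end(2) winner by simp
    qed
  next
    case (wins_own h mv)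
    show ?case
    proof (rule wins.wins_own)
      show "to_move starter (?\<phi> h) = p" using wins_own(1) to_move by simp
      show "legal_move V E (?\<phi> h) (map_prod \<rho> id mv)" using wins_own(2) by (rule legal)
      show "wins V E starter p (?\<phi> h @ [map_prod \<rho> id mv])" using wins_own(4) by (simp only: map_append list.map)
    qed
  next
    case (wins_other h)
    show ?case
    proof (rule wins.wins_other)
      show "to_move starter (?\<phi> h) \<noteq> p" using wins_other.hyps to_move by simp
      show "wins V E starter p (?\<phi> h @ [mv])" if "legal_move V E (?\<phi> h) mv" for mv
        using wins_other.IH[OF legal'[OF that]] by (simp only: map_append list.map twice1)
      show "winner V E (?\<phi> h) = p" if "\<nexists>mv. legal_move V E (?\<phi> h) mv"
        using that stuck winner wins_other.hyps by blast
    qed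
  qed
qed

section \<open>Graceful labelings of paths\<close>

lemma finite_path_verts [simp]: "finite (path_verts n)"
  by (simp add: path_verts_def)

lemma edge_mem_path_edges: "{i, Suc i} \<in> path_edges n \<longleftrightarrow> Suc i < n"
  by (auto simp: path_edges_def doubleton_eq_iff)

lemma path_edgesE:
  assumes "{u, v} \<in> path_edges n"
  obtains i where "Suc i < n" "u = i" "v = Suc i" | i where "Suc i < n" "u = Suc i" "v = i"
  using assms by (auto simp: path_edges_def doubleton_eq_iff)

text \<open>Absolute differences ignore the order of the endpoints and inequality is symmetric, so
  it suffices to compare two edges written upwards, the lower one first.\<close>

lemma edge_labels_distinct_path:
  assumes "\<And>i j a b c d. i < j \<Longrightarrow> Suc j < n \<Longrightarrow> f i = Some a \<Longrightarrow> f (Suc i) = Some b \<Longrightarrow>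
    f j = Some c \<Longrightarrow> f (Suc j) = Some d \<Longrightarrow> \<bar>int a - int b\<bar> \<noteq> \<bar>int c - int d\<bar>"
  shows "edge_labels_distinct (path_edges n) f"
proof -
  have *: "\<bar>int a - int b\<bar> \<noteq> \<bar>int c - int d\<bar>"
    if "i \<noteq> j" "Suc i < n" "Suc j < n" "f i = Some a" "f (Suc i) = Some b"
      "f j = Some c" "f (Suc j) = Some d" for i j a b c d
    using assms[of i j a b c d] assms[of j i c d a b] that by (cases "i < j") auto
  have orient: "\<exists>i a' b'. {u, v} = {i, Suc i} \<and> Suc i < n \<and> f i = Some a' \<and> f (Suc i) = Some b' \<and>
      \<bar>int a - int b\<bar> = \<bar>int a' - int b'\<bar>"
    if "{u, v} \<in> path_edges n" "f u = Some a" "f v = Some b" for u v a b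
    using that(1)
  proof (cases rule: path_edgesE)
    case (1 i)
    then show ?thesis using that by blast
  next
    case (2 i)
    then have "{u, v} = {i, Suc i}" by auto
    moreover have "\<bar>int a - int b\<bar> = \<bar>int b - int a\<bar>" by simp
    ultimately show ?thesis using that 2 by blast
  qed
  show ?thesis
    unfolding edge_labels_distinct_def
  proof (intro allI impI, elim conjE)
    fix u v x y a b c d
    assume uv: "{u, v} \<in> path_edges n" "f u = Some a" "f v = Some b"
      and xy: "{x, y} \<in> path_edges n" "f x = Some c" "f y = Some d" and ne: "{u, v} \<noteq> {x, y}"
    obtain i a' b' where i: "{u, v} = {i, Suc i}" "Suc i < n" "f i = Some a'" "f (Suc i) = Some b'"
      "\<bar>int a - int b\<bar> = \<bar>int a' - int b'\<bar>"
      using orient[OF uv] by blast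
    obtain j c' d' where j: "{x, y} = {j, Suc j}" "Suc j < n" "f j = Some c'" "f (Suc j) = Some d'"
      "\<bar>int c - int d\<bar> = \<bar>int c' - int d'\<bar>"
      using orient[OF xy] by blast
    have "i \<noteq> j" using ne i(1) j(1) by auto
    from *[OF this i(2) j(2) i(3,4) j(3,4)] show "\<bar>int a - int b\<bar> \<noteq> \<bar>int c - int d\<bar>"
      using i(5) j(5) by simp
  qed
qed

text \<open>Replaces \<open>map_of\<close> by membership in an explicit list of moves, so that
  legality in a short concrete history becomes a finite case distinction.\<close>

lemma legal_move_path:
  assumes "v < n" "v \<notin> fst ` set h" "l \<le> n - 1" "l \<notin> snd ` set h"
    and "\<And>i j a b c d. i < j \<Longrightarrow> Suc j < n \<Longrightarrow> (i, a) \<in> set ((v, l) # h) \<Longrightarrow>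
      (Suc i, b) \<in> set ((v, l) # h) \<Longrightarrow> (j, c) \<in> set ((v, l) # h) \<Longrightarrow>
      (Suc j, d) \<in> set ((v, l) # h) \<Longrightarrow> \<bar>int a - int b\<bar> \<noteq> \<bar>int c - int d\<bar>"
  shows "legal_move (path_verts n) (path_edges n) h (v, l)"
proof -
  have "l \<notin> ran (map_of h)"
    using assms(4) by (force simp: ran_def dest: map_of_SomeD)
  moreover have "(i, a) \<in> set ((v, l) # h)" if "((map_of h)(v \<mapsto> l)) i = Some a" for i a
    using that by (auto split: if_splits dest: map_of_SomeD)
  then have "edge_labels_distinct (path_edges n) ((map_of h)(v \<mapsto> l))"
    using assms(5) by (intro edge_labels_distinct_path) blast
  ultimately show ?thesis
    using assms(1-4) by (simp del: fun_upd_apply add: legal_move_def path_verts_def card_path_edges dom_map_of_conv_image_fst)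
qed

text \<open>As long as no two edges are fully labeled, there are no edge labels to compare. Most of
  Bob's moves are of this kind.\<close>

lemma legal_move_path_no_second_edge:
  assumes "v < n" "v \<notin> fst ` set h" "l \<le> n - 1" "l \<notin> snd ` set h"
    and "\<And>i j. i < j \<Longrightarrow> Suc j < n \<Longrightarrow> {i, Suc i, j, Suc j} \<subseteq> insert v (fst ` set h) \<Longrightarrow> False"
  shows "legal_move (path_verts n) (path_edges n) h (v, l)"
proof (rule legal_move_path[OF assms(1-4)])
  have dom: "i \<in> insert v (fst ` set h)" if "(i, a) \<in> set ((v, l) # h)" for i a
    using that by (auto intro: rev_image_eqI)
  fix i j a b c d
  assume "i < j" "Suc j < n" "(i, a) \<in> set ((v, l) # h)" "(Suc i, b) \<in> set ((v, l) # h)"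
    "(j, c) \<in> set ((v, l) # h)" "(Suc j, d) \<in> set ((v, l) # h)"
  moreover from this have "{i, Suc i, j, Suc j} \<subseteq> insert v (fst ` set h)"
    using dom by blast
  ultimately show "\<bar>int a - int b\<bar> \<noteq> \<bar>int c - int d\<bar>" using assms(5) by blast
qed

lemma legal_move_pathD:
  "legal_move (path_verts n) (path_edges n) h (v, l) \<Longrightarrow> v < n \<and> v \<notin> fst ` set h \<and> l \<le> n - 1"
  by (auto simp: legal_move_def path_verts_def card_path_edges dom_map_of_conv_image_fst)

section \<open>Forced positions of the labels 0, 1 and n - 1\<close>

text \<open>An edge is indexed by its lower endpoint, hence the bound \<open>n - 1\<close> in the
  last conjunct.\<close>

definition graceful_path :: "nat \<Rightarrow> (nat \<Rightarrow> nat) \<Rightarrow> bool" where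
  "graceful_path n g \<longleftrightarrow> inj_on g {..<n} \<and> (\<forall>i<n. g i \<le> n - 1) \<and>
     inj_on (\<lambda>i. \<bar>int (g i) - int (g (Suc i))\<bar>) {..<n - 1}"

lemma graceful_pathI:
  assumes "graceful_labeling (path_verts n) (path_edges n) g"
  shows "graceful_path n g"
proof -
  have "inj_on (\<lambda>i. \<bar>int (g i) - int (g (Suc i))\<bar>) {..<n - 1}"
  proof (rule inj_onI, rule ccontr)
    fix i j assume "i \<in> {..<n - 1}" "j \<in> {..<n - 1}" "i \<noteq> j"
      and eq: "\<bar>int (g i) - int (g (Suc i))\<bar> = \<bar>int (g j) - int (g (Suc j))\<bar>"
    then have "{i, Suc i} \<in> path_edges n" "{j, Suc j} \<in> path_edges n" "{i, Suc i} \<noteq> {j, Suc j}"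
      by (auto simp: edge_mem_path_edges doubleton_eq_iff)
    with eq assms show False unfolding graceful_labeling_def by blast
  qed
  then show ?thesis
    using assms by (auto simp: graceful_path_def graceful_labeling_def path_verts_def card_path_edges)
qed

lemma graceful_path_inj: "graceful_path n g \<Longrightarrow> g i = g j \<Longrightarrow> i < n \<Longrightarrow> j < n \<Longrightarrow> i = j"
  by (simp add: graceful_path_def inj_on_def)

lemma graceful_path_distinct:
  assumes "graceful_path n g"
  shows "distinct (map g [0..<n])" "distinct (map (\<lambda>i. \<bar>int (g i) - int (g (Suc i))\<bar>) [0..<n - 1])"
  using assms by (auto simp: graceful_path_def distinct_map atLeast0LessThan)

text \<open>The \<open>n - 1\<close> edge labels are pairwise distinct and lie in
  \<open>{1..n - 1}\<close>, so each value is attained.\<close>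

lemma graceful_path_edge_label:
  assumes "graceful_path n g" "1 \<le> k" "k \<le> n - 1"
  obtains i where "Suc i < n" "\<bar>int (g i) - int (g (Suc i))\<bar> = int k"
proof -
  let ?d = "\<lambda>i. \<bar>int (g i) - int (g (Suc i))\<bar>"
  have "?d ` {..<n - 1} \<subseteq> {1..int (n - 1)}"
  proof
    fix x assume "x \<in> ?d ` {..<n - 1}"
    then obtain i where i: "Suc i < n" "x = ?d i" by (auto simp: less_diff_conv)
    have "g i \<noteq> g (Suc i)" "g i \<le> n - 1" "g (Suc i) \<le> n - 1"
      using assms(1) i graceful_path_inj[of n g i "Suc i"] by (auto simp: graceful_path_def)
    then show "x \<in> {1..int (n - 1)}" using i by auto
  qed
  moreover have "card (?d ` {..<n - 1}) = n - 1"
    using assms(1) by (simp add: card_image graceful_path_def)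
  ultimately have "?d ` {..<n - 1} = {1..int (n - 1)}"
    by (intro card_subset_eq) auto
  moreover have "int k \<in> {1..int (n - 1)}" using assms by simp
  ultimately have "int k \<in> ?d ` {..<n - 1}" by simp
  with that show thesis by (auto simp: less_diff_conv)
qed

text \<open>The edge label \<open>n - 1\<close> occurs, and only the labels \<open>0\<close> and
  \<open>n - 1\<close> differ by that much.\<close>

lemma graceful_path_extremes_adjacent:
  assumes "graceful_path n g" "u < n" "v < n" "g u = 0" "g v = n - 1" "2 \<le> n"
  shows "v = Suc u \<or> u = Suc v"
proof -
  have "1 \<le> n - 1" using assms(6) by simp
  then obtain i where i: "Suc i < n" "\<bar>int (g i) - int (g (Suc i))\<bar> = int (n - 1)"
    using graceful_path_edge_label[OF assms(1), of "n - 1"] by blast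
  have "g i \<le> n - 1" "g (Suc i) \<le> n - 1"
    using assms(1) i by (auto simp: graceful_path_def)
  then have "g i = 0 \<and> g (Suc i) = n - 1 \<or> g i = n - 1 \<and> g (Suc i) = 0"
    using i assms(6) by linarith
  then show ?thesis
    using graceful_path_inj[OF assms(1)] i assms by (metis Suc_lessD)
qed

text \<open>The only neighbor of \<open>0\<close> must carry \<open>n - 1\<close>. The edge label
  \<open>n - 2\<close> then cannot come from \<open>0\<close> and \<open>n - 2\<close>, so it comes
  from \<open>1\<close> and \<open>n - 1\<close>, and \<open>1\<close> takes the other neighbor of
  \<open>n - 1\<close>.\<close>

lemma graceful_path_zero_at_end:
  assumes "graceful_path n g" "g (n - 1) = 0" "4 \<le> n"
  shows "g (n - 2) = n - 1 \<and> g (n - 3) = 1"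
proof -
  have le: "\<And>i. i < n \<Longrightarrow> g i \<le> n - 1"
    using assms(1) by (auto simp: graceful_path_def)
  note eqD = graceful_path_inj[OF assms(1)]
  have bounds: "1 \<le> n - 1" "1 \<le> n - 2" "n - 2 \<le> n - 1" using assms(3) by auto
  then obtain i where i: "Suc i < n" "\<bar>int (g i) - int (g (Suc i))\<bar> = int (n - 1)"
    using graceful_path_edge_label[OF assms(1), of "n - 1"] by blast
  have "g i = 0 \<and> g (Suc i) = n - 1 \<or> g i = n - 1 \<and> g (Suc i) = 0"
    using i le[of i] le[of "Suc i"] assms(3) by linarith
  then have "Suc i = n - 1" "g i = n - 1"
    using eqD[of i "n - 1"] eqD[of "Suc i" "n - 1"] i(1) assms by auto
  moreover from this have "i = n - 2" by simp
  ultimately have last: "g (n - 2) = n - 1" by simp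
  obtain j where j: "Suc j < n" "\<bar>int (g j) - int (g (Suc j))\<bar> = int (n - 2)"
    using graceful_path_edge_label[OF assms(1), of "n - 2"] bounds by blast
  \<comment> \<open>All ways to obtain the difference \<open>n - 2\<close>. Only the third fits: the
    others contradict the last vertex having label \<open>0\<close> or its neighbor having label
    \<open>n - 1\<close>.\<close>
  consider "g j = 0" "g (Suc j) = n - 2" | "g j = n - 2" "g (Suc j) = 0"
    | "g j = 1" "g (Suc j) = n - 1" | "g j = n - 1" "g (Suc j) = 1"
    using j le[of j] le[of "Suc j"] assms(3) by linarith
  then have "g (n - 3) = 1"
  proof cases
    case 1
    then show ?thesis using eqD[of j "n - 1"] j assms by auto
  next
    case 2
    then have "Suc j = n - 1" using eqD[of "Suc j" "n - 1"] j assms by auto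
    then have "j = n - 2" by simp
    then show ?thesis using 2 last assms by simp
  next
    case 3
    then have "Suc j = n - 2" using eqD[of "Suc j" "n - 2"] j last assms by auto
    then have "j = n - 3" by simp
    then show ?thesis using 3 by simp
  next
    case 4
    then have "j = n - 2" using eqD[of j "n - 2"] j last assms by auto
    then have "Suc j = n - 1" using j by simp
    then show ?thesis using 4 assms by simp
  qed
  with last show ?thesis by simp
qed

lemma wins_Bob_path_if_contradictory:
  assumes "distinct (map fst h)"
    and "\<And>g. graceful_path n g \<Longrightarrow> \<forall>(v, l)\<in>set h. g v = l \<Longrightarrow> False"
  shows "wins (path_verts n) (path_edges n) starter Bob h"
proof (rule wins_Bob_if_doomed)
  show "doomed (path_verts n) (path_edges n) h"
    unfolding doomed_def using assms(2) graceful_pathI by blast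
qed (use assms(1) in auto)

lemma wins_reflected_path:
  assumes "wins (path_verts n) (path_edges n) starter p [(n - 1 - w, l)]" "w < n"
  shows "wins (path_verts n) (path_edges n) starter p [(w, l)]"
proof -
  \<comment> \<open>Truncated subtraction is not injective beyond the path; the identity there makes
    the reflection an involution on all of \<open>nat\<close>.\<close>
  let ?\<rho> = "\<lambda>v. if v < n then n - 1 - v else v"
  have "wins (path_verts n) (path_edges n) starter p (map (map_prod ?\<rho> id) [(n - 1 - w, l)])"
  proof (rule wins_automorphism)
    show "?\<rho> (?\<rho> v) = v" for v by auto
    show "?\<rho> v \<in> path_verts n" if "v \<in> path_verts n" for v
      using that by (auto simp: path_verts_def)
    show "{?\<rho> u, ?\<rho> v} \<in> path_edges n" if "{u, v} \<in> path_edges n" for u v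
      using that
    proof (cases rule: path_edgesE)
      case (1 i)
      then have "?\<rho> u = Suc (n - 1 - v)" "?\<rho> v = n - 1 - v" by auto
      then show ?thesis using 1 edge_mem_path_edges[of "n - 1 - v" n] by (auto simp: insert_commute)
    next
      case (2 i)
      then have "?\<rho> v = Suc (n - 1 - u)" "?\<rho> u = n - 1 - u" by auto
      then show ?thesis using 2 edge_mem_path_edges[of "n - 1 - u" n] by auto
    qed
  qed (fact assms(1))
  moreover have "map (map_prod ?\<rho> id) [(n - 1 - w, l)] = [(w, l)]" using assms(2) by auto
  ultimately show ?thesis by simp
qed

section \<open>Bob wins on long paths\<close>

text \<open>A free vertex \<open>v\<close> settles the case that Alice is stuck: the labeling is
  partial and Bob has won. Only her legal moves remain to be answered.\<close>

lemma wins_Bob_incomplete: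
  assumes "to_move starter h = Alice" "v \<in> V" "v \<notin> fst ` set h"
    and "\<And>v l. legal_move V E h (v, l) \<Longrightarrow> wins V E starter Bob (h @ [(v, l)])"
  shows "wins V E starter Bob h"
proof (rule wins_other)
  have "dom (map_of h) \<noteq> V" using assms(2,3) by (auto simp: dom_map_of_conv_image_fst)
  then show "winner V E h = Bob" by (simp add: winner_def)
qed (use assms in auto)

lemma wins_Bob_first:
  assumes n: "4 \<le> n"
  shows "wins (path_verts n) (path_edges n) Bob Bob []"
proof (rule wins_own)
  show "legal_move (path_verts n) (path_edges n) [] (n - 1, 0)"
    by (rule legal_move_path_no_second_edge) (use n in auto)
  show "wins (path_verts n) (path_edges n) Bob Bob ([] @ [(n - 1, 0)])"
  proof (rule wins_Bob_incomplete)
    fix w l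
    assume "legal_move (path_verts n) (path_edges n) ([] @ [(n - 1, 0)]) (w, l)"
    then have w: "w < n" "w \<noteq> n - 1" "l \<le> n - 1" by (auto dest: legal_move_pathD)
    \<comment> \<open>Either Alice already violates the forced rule that the vertex
      \<open>n - 2\<close> and the label \<open>n - 1\<close> go together, or she obeys it, or she
      touches neither of them.\<close>
    consider (dead) "(w = n - 2) \<noteq> (l = n - 1)" | (forced) "w = n - 2" "l = n - 1"
      | (elsewhere) "w < n - 2" "l \<noteq> n - 1" using w by linarith
    then have "wins (path_verts n) (path_edges n) Bob Bob [(n - 1, 0), (w, l)]"
    proof cases
      case dead
      show ?thesis
      proof (rule wins_Bob_path_if_contradictory)
        fix g assume "graceful_path n g" "\<forall>(v, l)\<in>set [(n - 1, 0), (w, l)]. g v = l"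
        then show False
          using graceful_path_zero_at_end[of n g] n dead w graceful_path_extremes_adjacent[of n g "n - 1" w]
          by auto
      qed (use w in auto)
    next
      case forced
      show ?thesis
      proof (rule wins_own)
        \<comment> \<open>The label \<open>1\<close> is now forced at vertex \<open>n - 3\<close>,
          which differs from \<open>0\<close> because \<open>4 \<le> n\<close>.\<close>
        show "legal_move (path_verts n) (path_edges n) [(n - 1, 0), (w, l)] (0, 1)"
          by (rule legal_move_path_no_second_edge) (use n forced in auto)
        show "wins (path_verts n) (path_edges n) Bob Bob ([(n - 1, 0), (w, l)] @ [(0, 1)])"
        proof (rule wins_Bob_path_if_contradictory)
          fix g assume g: "graceful_path n g" "\<forall>(v, l)\<in>set ([(n - 1, 0), (w, l)] @ [(0, 1)]). g v = l"
          then have "g (n - 3) = g 0" using graceful_path_zero_at_end[of n g] n by auto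
          from graceful_path_inj[OF g(1) this] show False using n by simp
        qed (use n forced in auto)
      qed (simp add: to_move_def)
    next
      case elsewhere
      \<comment> \<open>A free vertex not adjacent to the one labeled \<open>0\<close>. Vertex
        \<open>n - 2\<close> stays free, so only an edge between \<open>u\<close> and
        \<open>w\<close> can become labeled.\<close>
      define u where "u = (if w = 0 then 1 else 0 :: nat)"
      have u: "u \<noteq> w" "u < n - 2" "u < n" using n by (auto simp: u_def)
      show ?thesis
      proof (rule wins_own)
        show "legal_move (path_verts n) (path_edges n) [(n - 1, 0), (w, l)] (u, n - 1)"
          by (rule legal_move_path_no_second_edge) (use n elsewhere u in auto)
        show "wins (path_verts n) (path_edges n) Bob Bob ([(n - 1, 0), (w, l)] @ [(u, n - 1)])"
        proof (rule wins_Bob_path_if_contradictory)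
          fix g assume g: "graceful_path n g" "\<forall>(v, l)\<in>set ([(n - 1, 0), (w, l)] @ [(u, n - 1)]). g v = l"
          then show False using graceful_path_extremes_adjacent[of n g "n - 1" u] n u by auto
        qed (use n elsewhere u in auto)
      qed (simp add: to_move_def)
    qed
    then show "wins (path_verts n) (path_edges n) Bob Bob (([] @ [(n - 1, 0)]) @ [(w, l)])" by simp
  next
    show "0 \<in> path_verts n" "0 \<notin> fst ` set ([] @ [(n - 1, 0)])"
      using n by (auto simp: path_verts_def)
  qed (simp add: to_move_def)
qed (simp add: to_move_def)

lemma wins_Bob_after_extreme_label:
  assumes n: "4 \<le> n" and w: "w < n" and l: "l = 0 \<or> l = n - 1"
  shows "wins (path_verts n) (path_edges n) Alice Bob [(w, l)]"
proof -
  \<comment> \<open>A vertex at distance at least two from \<open>w\<close>; vertex \<open>3\<close>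
    exists since \<open>4 \<le> n\<close>. It gets \<open>n - 1 - l\<close>, the other extreme
    label.\<close>
  define u where "u = (if w \<le> 1 then 3 else if w = 2 then 0 else (w - 2) :: nat)"
  have u: "u < n" "u \<noteq> w" "u \<noteq> Suc w" "w \<noteq> Suc u" using n w by (auto simp: u_def)
  show ?thesis
  proof (rule wins_own)
    show "legal_move (path_verts n) (path_edges n) [(w, l)] (u, n - 1 - l)"
      by (rule legal_move_path_no_second_edge) (use n l u in auto)
    show "wins (path_verts n) (path_edges n) Alice Bob ([(w, l)] @ [(u, n - 1 - l)])"
    proof (rule wins_Bob_path_if_contradictory)
      fix g assume g: "graceful_path n g" "\<forall>(v, l)\<in>set ([(w, l)] @ [(u, n - 1 - l)]). g v = l"
      then show False
        using graceful_path_extremes_adjacent[of n g u w] graceful_path_extremes_adjacent[of n g w u]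
          n u w l by auto
    qed (use u in auto)
  qed (simp add: to_move_def)
qed

section \<open>Openings with an inner label on at least six vertices\<close>

text \<open>Bob wants to put \<open>n - 1\<close> away from the end labeled \<open>0\<close>. If
  \<open>w\<close> and \<open>w'\<close> are adjacent, the new edge at \<open>u\<close> may repeat
  their edge label. Usually \<open>u\<close> can keep clear of both; if they occupy \<open>1\<close>
  and \<open>2\<close>, the candidates \<open>0\<close> and \<open>3\<close> cannot both clash,
  since that would give \<open>l = l'\<close>. The bound on \<open>n\<close> makes vertex
  \<open>3\<close> available.\<close>

lemma ex_place_for_top_label:
  fixes n w w' l l' :: nat
  assumes "6 \<le> n" "w < n - 3" "w' < n - 2" "w \<noteq> w'" "l \<noteq> l'" "l < n - 1" "l' < n - 1"
  obtains u where "u < n - 2" "u \<noteq> w" "u \<noteq> w'"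
    "w = Suc u \<or> u = Suc w \<Longrightarrow> w' = Suc w \<or> w = Suc w' \<Longrightarrow> int (n - 1) - int l \<noteq> \<bar>int l - int l'\<bar>"
    "w' = Suc u \<or> u = Suc w' \<Longrightarrow> w' = Suc w \<or> w = Suc w' \<Longrightarrow> int (n - 1) - int l' \<noteq> \<bar>int l - int l'\<bar>"
proof -
  let ?D = "\<bar>int l - int l'\<bar>" and ?m = "int (n - 1)"
  have "\<exists>u<n - 2. u \<noteq> w \<and> u \<noteq> w' \<and> (w' = Suc w \<or> w = Suc w' \<longrightarrow>
      (w = Suc u \<or> u = Suc w \<longrightarrow> ?m - int l \<noteq> ?D) \<and> (w' = Suc u \<or> u = Suc w' \<longrightarrow> ?m - int l' \<noteq> ?D))"
  proof (cases "w' = Suc w \<or> w = Suc w'")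
    case False
    define u where "u = (if 0 \<notin> {w, w'} then 0 else if 1 \<notin> {w, w'} then 1 else 2 :: nat)"
    have "u < n - 2" "u \<noteq> w" "u \<noteq> w'" using assms(1) by (auto simp: u_def)
    with False show ?thesis by blast
  next
    case True
    consider "min w w' = 0" | "min w w' = 1" | "2 \<le> min w w'" by linarith
    then show ?thesis
    proof cases
      case 1
      then show ?thesis using True assms(1) by (intro exI[of _ 3]) auto
    next
      case 2
      have "?m - int l \<noteq> ?D \<or> ?m - int l' \<noteq> ?D" using assms(5) by linarith
      then consider "?m - int (if w = 1 then l else l') \<noteq> ?D" | "?m - int (if w = 1 then l' else l) \<noteq> ?D"
        by (cases "w = 1") auto
      then show ?thesis
      proof cases
        case 1
        then show ?thesis using True 2 assms(1) by (intro exI[of _ 0]) (auto split: if_splits)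
      next
        case 2
        then show ?thesis using True \<open>min w w' = 1\<close> assms(1) by (intro exI[of _ 3]) (auto split: if_splits)
      qed
    next
      case 3
      then show ?thesis using True assms(1) by (intro exI[of _ 0]) auto
    qed
  qed
  then show thesis using that by blast
qed

text \<open>The plan of \<open>wins_Bob_first\<close>, with Alice's opening as an additional labeled
  vertex. Since \<open>w < n - 3\<close>, it lies outside the last three vertices, where the forced
  labels belong.\<close>

lemma wins_Bob_after_first_move_large:
  assumes n: "6 \<le> n" and w: "w < n - 3" and l: "0 < l" "l < n - 1"
  shows "wins (path_verts n) (path_edges n) Alice Bob [(w, l)]"
proof (rule wins_own)
  show "legal_move (path_verts n) (path_edges n) [(w, l)] (n - 1, 0)"
    by (rule legal_move_path_no_second_edge) (use n w l in auto)
  show "wins (path_verts n) (path_edges n) Alice Bob ([(w, l)] @ [(n - 1, 0)])"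
  proof (rule wins_Bob_incomplete)
    fix w' l'
    assume legal: "legal_move (path_verts n) (path_edges n) ([(w, l)] @ [(n - 1, 0)]) (w', l')"
    then have w': "w' < n" "w' \<noteq> n - 1" "w' \<noteq> w" "l' \<le> n - 1" by (auto dest: legal_move_pathD)
    have l': "l' \<noteq> l" using legal by (auto simp: legal_move_def ran_def split: if_splits)
    consider (dead) "(w' = n - 2) \<noteq> (l' = n - 1)" | (forced) "w' = n - 2" "l' = n - 1"
      | (elsewhere) "w' < n - 2" "l' < n - 1" using w' by linarith
    then have "wins (path_verts n) (path_edges n) Alice Bob [(w, l), (n - 1, 0), (w', l')]"
    proof cases
      case dead
      show ?thesis
      proof (rule wins_Bob_path_if_contradictory)
        fix g assume "graceful_path n g" "\<forall>(v, l)\<in>set [(w, l), (n - 1, 0), (w', l')]. g v = l"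
        then show False
          using graceful_path_zero_at_end[of n g] n dead w' graceful_path_extremes_adjacent[of n g "n - 1" w']
          by auto
      qed (use w w' in auto)
    next
      case forced
      show ?thesis
      \<comment> \<open>If Alice opened with label \<open>1\<close>, it is already misplaced,
        because \<open>w\<close> is not \<open>n - 3\<close>; otherwise Bob misplaces it
        himself.\<close>
      proof (cases "l = 1")
        case True
        show ?thesis
        proof (rule wins_Bob_path_if_contradictory)
          fix g assume g: "graceful_path n g" "\<forall>(v, l)\<in>set [(w, l), (n - 1, 0), (w', l')]. g v = l"
          then have "g (n - 3) = g w" using graceful_path_zero_at_end[of n g] n True by auto
          moreover have "n - 3 < n" "w < n" "n - 3 \<noteq> w" using n w by auto
          ultimately show False using graceful_path_inj[OF g(1)] by blast
        qed (use w w' in auto)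
      next
        case False
        define u where "u = (if w = 0 then 1 else 0 :: nat)"
        have u: "u \<noteq> w" "u < n - 3" "u < n" using n by (auto simp: u_def)
        show ?thesis
        proof (rule wins_own)
          show "legal_move (path_verts n) (path_edges n) [(w, l), (n - 1, 0), (w', l')] (u, 1)"
          proof (rule legal_move_path)
            fix i j a b c d
            let ?S = "set ((u, 1) # [(w, l), (n - 1, 0), (w', l')])"
            assume ij: "i < j" "Suc j < n" and S: "(i, a) \<in> ?S" "(Suc i, b) \<in> ?S" "(j, c) \<in> ?S" "(Suc j, d) \<in> ?S"
            \<comment> \<open>The last edge has label \<open>n - 1\<close>. The only other edge that
              can be labeled joins \<open>u\<close> and \<open>w\<close>, and its label is
              smaller.\<close>
            have "i < n - 3" "Suc i < n - 3" using ij S(1,2) forced u w n by auto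
            then have "i \<in> {u, w}" "Suc i \<in> {u, w}" "a \<in> {1, l}" "b \<in> {1, l}"
              using S(1,2) forced n by auto
            moreover from this have "j = n - 2" using ij S(3,4) forced u w n by auto
            then have "c = n - 1" "d = 0" using S(3,4) forced u w n by auto
            ultimately show "\<bar>int a - int b\<bar> \<noteq> \<bar>int c - int d\<bar>" using l n by auto
          qed (use n forced u False l in auto)
          show "wins (path_verts n) (path_edges n) Alice Bob ([(w, l), (n - 1, 0), (w', l')] @ [(u, 1)])"
          proof (rule wins_Bob_path_if_contradictory)
            fix g assume g: "graceful_path n g"
              "\<forall>(v, l)\<in>set ([(w, l), (n - 1, 0), (w', l')] @ [(u, 1)]). g v = l"
            then have "g (n - 3) = g u" using graceful_path_zero_at_end[of n g] n by auto
            from graceful_path_inj[OF g(1) this] show False using n u by simp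
          qed (use n w w' forced u in auto)
        qed (simp add: to_move_def)
      qed
    next
      case elsewhere
      obtain u where u: "u < n - 2" "u \<noteq> w" "u \<noteq> w'"
        and clash: "w = Suc u \<or> u = Suc w \<Longrightarrow> w' = Suc w \<or> w = Suc w' \<Longrightarrow>
            int (n - 1) - int l \<noteq> \<bar>int l - int l'\<bar>"
          "w' = Suc u \<or> u = Suc w' \<Longrightarrow> w' = Suc w \<or> w = Suc w' \<Longrightarrow>
            int (n - 1) - int l' \<noteq> \<bar>int l - int l'\<bar>"
        using ex_place_for_top_label[OF n w elsewhere(1) w'(3)[symmetric] l'[symmetric] l(2) elsewhere(2)]
        by blast
      show ?thesis
      proof (rule wins_own)
        show "legal_move (path_verts n) (path_edges n) [(w, l), (n - 1, 0), (w', l')] (u, n - 1)"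
        proof (rule legal_move_path)
          fix i j a b c d
          let ?S = "set ((u, n - 1) # [(w, l), (n - 1, 0), (w', l')])"
            and ?T = "{(u, n - 1), (w, l), (w', l')}"
          assume ij: "i < j" "Suc j < n" and S: "(i, a) \<in> ?S" "(Suc i, b) \<in> ?S" "(j, c) \<in> ?S" "(Suc j, d) \<in> ?S"
          \<comment> \<open>Vertex \<open>n - 2\<close> is free, so the end labeled \<open>0\<close>
            lies on no labeled edge.\<close>
          have "Suc j \<noteq> n - 1" using S(3) u w elsewhere n by auto
          then have "i \<noteq> n - 1" "Suc i \<noteq> n - 1" "j \<noteq> n - 1" using ij by auto
          then have "(i, a) \<in> ?T" "(Suc i, b) \<in> ?T" "(j, c) \<in> ?T" "(Suc j, d) \<in> ?T"
            using S \<open>Suc j \<noteq> n - 1\<close> by auto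
          note T = this
          \<comment> \<open>Two edges within three vertices share a vertex, so \<open>u\<close>,
            \<open>w\<close>, \<open>w'\<close> are consecutive in some order.\<close>
          have "{i, Suc i, j, Suc j} \<subseteq> {u, w, w'}" using T by auto
          then have "card {i, Suc i, j, Suc j} \<le> card {u, w, w'}" by (rule card_mono[rotated]) simp
          also have "\<dots> \<le> 3" by (simp add: card_insert_if)
          finally have j: "j = Suc i" using ij(1) by (auto simp: card_insert_if split: if_splits)
          have c: "c = b" using T(2,3) u(2,3) w'(3) j by auto
          \<comment> \<open>Which vertex is in the middle? With \<open>u\<close> there, the edge
            labels \<open>n - 1 - l\<close> and \<open>n - 1 - l'\<close> differ because
            \<open>l \<noteq> l'\<close>; otherwise the choice of \<open>u\<close> excludes the
            clash.\<close>
          from T(2) consider "Suc i = u" "b = n - 1" | "Suc i = w" "b = l" | "Suc i = w'" "b = l'" by auto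
          then show "\<bar>int a - int b\<bar> \<noteq> \<bar>int c - int d\<bar>"
          proof cases
            case 1
            then have "a \<in> {l, l'}" "d \<in> {l, l'}" "a = d \<longrightarrow> i = Suc (Suc i)"
              using T(1,4) j l' by auto
            then show ?thesis using 1 c l(2) elsewhere(2) by auto
          next
            case 2
            then have ad: "a = n - 1 \<and> d = l' \<and> i = u \<and> Suc j = w' \<or> a = l' \<and> d = n - 1 \<and> i = w' \<and> Suc j = u"
              using T(1,4) j by auto
            then have "int (n - 1) - int l \<noteq> \<bar>int l - int l'\<bar>" using 2 j by (intro clash(1)) auto
            then show ?thesis using ad 2 c l(2) by linarith
          next
            case 3
            then have ad: "a = n - 1 \<and> d = l \<and> i = u \<and> Suc j = w \<or> a = l \<and> d = n - 1 \<and> i = w \<and> Suc j = u"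
              using T(1,4) j by auto
            then have "int (n - 1) - int l' \<noteq> \<bar>int l - int l'\<bar>" using 3 j by (intro clash(2)) auto
            then show ?thesis using ad 3 c elsewhere(2) by linarith
          qed
        next
          show "u < n" using u(1) by simp
          show "u \<notin> fst ` set [(w, l), (n - 1, 0), (w', l')]" using u by auto
          show "n - 1 \<notin> snd ` set [(w, l), (n - 1, 0), (w', l')]" using n l(2) elsewhere(2) by simp
        qed simp
        show "wins (path_verts n) (path_edges n) Alice Bob ([(w, l), (n - 1, 0), (w', l')] @ [(u, n - 1)])"
        proof (rule wins_Bob_path_if_contradictory)
          fix g assume g: "graceful_path n g"
            "\<forall>(v, l)\<in>set ([(w, l), (n - 1, 0), (w', l')] @ [(u, n - 1)]). g v = l"
          moreover have "u < n" using u by simp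
          ultimately show False using graceful_path_extremes_adjacent[of n g "n - 1" u] n u by auto
        qed (use n w w' elsewhere u in auto)
      qed (simp add: to_move_def)
    qed
    then show "wins (path_verts n) (path_edges n) Alice Bob (([(w, l)] @ [(n - 1, 0)]) @ [(w', l')])" by simp
  next
    show "n - 2 \<in> path_verts n" "n - 2 \<notin> fst ` set ([(w, l)] @ [(n - 1, 0)])"
      using n w by (auto simp: path_verts_def)
  qed (simp add: to_move_def)
qed (simp add: to_move_def)

section \<open>Openings with an inner label on four or five vertices\<close>

text \<open>The variables are the labels along the path, and the last assumption lists the positions
  after Alice's opening \<open>l\<close> and Bob's reply. Of the finitely many completions, each
  repeats a vertex label or an edge label.\<close>

lemma no_graceful_completion_4:
  fixes a b c d l :: nat
  assumes "a \<le> 3" "b \<le> 3" "c \<le> 3" "d \<le> 3" "distinct [a, b, c, d]"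
    "distinct [\<bar>int a - int b\<bar>, \<bar>int b - int c\<bar>, \<bar>int c - int d\<bar>]"
    "0 < l" "l < 3" "a = l \<and> b = (if 2 * l \<le> 3 then 0 else 3) \<or> a = 0 \<and> b = l"
  shows False
proof -
  have "l = 1 \<or> l = 2" "c = 0 \<or> c = 1 \<or> c = 2 \<or> c = 3" "d = 0 \<or> d = 1 \<or> d = 2 \<or> d = 3"
    using assms by linarith+
  then show False using assms(5,6,9) by (elim disjE) simp_all
qed

text \<open>The same check with one more vertex; \<open>c = l\<close> stands for an opening at the
  middle of the path.\<close>

lemma no_graceful_completion_5:
  fixes a b c d e l :: nat
  assumes "a \<le> 4" "b \<le> 4" "c \<le> 4" "d \<le> 4" "e \<le> 4" "distinct [a, b, c, d, e]"
    "distinct [\<bar>int a - int b\<bar>, \<bar>int b - int c\<bar>, \<bar>int c - int d\<bar>, \<bar>int d - int e\<bar>]"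
    "0 < l" "l < 4" "(a = l \<or> c = l) \<and> b = (if 2 * l \<le> 4 then 0 else 4) \<or> a = 0 \<and> b = l"
  shows False
proof -
  have small: "v = 0 \<or> v = 1 \<or> v = 2 \<or> v = 3 \<or> v = 4" if "v \<le> 4" for v :: nat
    using that by linarith
  have l: "l = 1 \<or> l = 2 \<or> l = 3" using assms by linarith
  from assms(10) consider "a = l" "b = (if 2 * l \<le> 4 then 0 else 4)"
    | "c = l" "b = (if 2 * l \<le> 4 then 0 else 4)" | "a = 0" "b = l"
    by blast
  then show False
  proof cases
    case 1
    then show ?thesis
      using l small[OF assms(3)] small[OF assms(4)] small[OF assms(5)] assms(6,7) by (elim disjE) simp_all
  next
    case 2
    then show ?thesis
      using l small[OF assms(1)] small[OF assms(4)] small[OF assms(5)] assms(6,7) by (elim disjE) simp_all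
  next
    case 3
    then show ?thesis
      using l small[OF assms(3)] small[OF assms(4)] small[OF assms(5)] assms(6,7) by (elim disjE) simp_all
  qed
qed

text \<open>On these two paths the general strategy may lack a legal spoiling move, but Bob has a reply to
  Alice's opening that already leaves no graceful completion.\<close>

lemma wins_Bob_after_first_move_small:
  assumes n: "n = 4 \<or> n = 5" and w: "w < n - 2" and l: "0 < l" "l < n - 1"
  shows "wins (path_verts n) (path_edges n) Alice Bob [(w, l)]"
proof -
  \<comment> \<open>Bob answers next to \<open>w\<close>. If \<open>w = 1\<close>, he puts
    \<open>0\<close> at the end, whose neighbor then has the wrong label \<open>l\<close>. Otherwise
    vertex \<open>1\<close> gets whichever of \<open>0\<close> and \<open>n - 1\<close> is nearer to
    \<open>l\<close>, with \<open>0\<close> in a tie.\<close>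
  define u :: nat where "u = (if w = 1 then 0 else 1)"
  define x where "x = (if w = 1 \<or> 2 * l \<le> n - 1 then 0 else n - 1)"
  show ?thesis
  proof (rule wins_own)
    show "legal_move (path_verts n) (path_edges n) [(w, l)] (u, x)"
      by (rule legal_move_path_no_second_edge) (use n w l in \<open>auto simp: u_def x_def\<close>)
    show "wins (path_verts n) (path_edges n) Alice Bob ([(w, l)] @ [(u, x)])"
    proof (rule wins_Bob_path_if_contradictory)
      fix g assume g: "graceful_path n g" "\<forall>(v, l)\<in>set ([(w, l)] @ [(u, x)]). g v = l"
      have le: "g i \<le> n - 1" if "i < n" for i
        using g(1) that by (simp add: graceful_path_def)
      have at: "g w = l" "g u = x" using g(2) by auto
      from n show False
      proof
        assume n: "n = 4"
        then consider "w = 0" | "w = 1" using w by linarith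
        then have "g 0 = l \<and> g 1 = (if 2 * l \<le> 3 then 0 else 3) \<or> g 0 = 0 \<and> g 1 = l"
          by cases (use at n in \<open>simp_all add: u_def x_def\<close>)
        moreover have "distinct [g 0, g 1, g 2, g 3]"
          using graceful_path_distinct(1)[OF g(1)] n by (simp add: upt_rec eval_nat_numeral)
        moreover have "distinct [\<bar>int (g 0) - int (g 1)\<bar>, \<bar>int (g 1) - int (g 2)\<bar>, \<bar>int (g 2) - int (g 3)\<bar>]"
          using graceful_path_distinct(2)[OF g(1)] n by (simp add: upt_rec eval_nat_numeral)
        ultimately show False
          using no_graceful_completion_4[of "g 0" "g 1" "g 2" "g 3" l] le[of 0] le[of 1] le[of 2] le[of 3] l n
          by simp
      next
        assume n: "n = 5"
        then consider "w = 0" | "w = 1" | "w = 2" using w by linarith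
        then have "(g 0 = l \<or> g 2 = l) \<and> g 1 = (if 2 * l \<le> 4 then 0 else 4) \<or> g 0 = 0 \<and> g 1 = l"
          by cases (use at n in \<open>simp_all add: u_def x_def\<close>)
        moreover have "distinct [g 0, g 1, g 2, g 3, g 4]"
          using graceful_path_distinct(1)[OF g(1)] n by (simp add: upt_rec eval_nat_numeral)
        moreover have "distinct [\<bar>int (g 0) - int (g 1)\<bar>, \<bar>int (g 1) - int (g 2)\<bar>, \<bar>int (g 2) - int (g 3)\<bar>,
            \<bar>int (g 3) - int (g 4)\<bar>]"
          using graceful_path_distinct(2)[OF g(1)] n by (simp add: upt_rec eval_nat_numeral)
        ultimately show False
          using no_graceful_completion_5[of "g 0" "g 1" "g 2" "g 3" "g 4" l] le[of 0] le[of 1] le[of 2]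
            le[of 3] le[of 4] l n
          by simp
      qed
    qed (auto simp: u_def)
  qed (simp add: to_move_def)
qed

lemma wins_Bob_second:
  assumes n: "4 \<le> n"
  shows "wins (path_verts n) (path_edges n) Alice Bob []"
proof (rule wins_Bob_incomplete)
  fix w l
  assume "legal_move (path_verts n) (path_edges n) [] (w, l)"
  then have w: "w < n" "l \<le> n - 1" by (auto dest: legal_move_pathD)
  let ?wins = "\<lambda>w. wins (path_verts n) (path_edges n) Alice Bob [(w, l)]"
  consider (extreme) "l = 0 \<or> l = n - 1" | (small) "n = 4 \<or> n = 5" "0 < l" "l < n - 1"
    | (large) "6 \<le> n" "0 < l" "l < n - 1"
    using w n by linarith
  then have "?wins w"
  proof cases
    case extreme
    then show ?thesis using wins_Bob_after_extreme_label n w by blast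
  next
    case small
    show ?thesis
    proof (cases "w < n - 2")
      case True
      then show ?thesis using wins_Bob_after_first_move_small small by blast
    next
      case False
      then have "n - 1 - w < n - 2" using n by linarith
      then have "?wins (n - 1 - w)" using wins_Bob_after_first_move_small small by blast
      then show ?thesis using w(1) by (rule wins_reflected_path)
    qed
  next
    case large
    show ?thesis
    proof (cases "w < n - 3")
      case True
      then show ?thesis using wins_Bob_after_first_move_large large by blast
    next
      case False
      \<comment> \<open>The reflected opening is at vertex \<open>2\<close> or below, which is less
        than \<open>n - 3\<close> because \<open>6 \<le> n\<close>.\<close>
      then have "n - 1 - w < n - 3" using large by linarith
      then have "?wins (n - 1 - w)" using wins_Bob_after_first_move_large large by blast
      then show ?thesis using w(1) by (rule wins_reflected_path)
    qed
  qed
  then show "wins (path_verts n) (path_edges n) Alice Bob ([] @ [(w, l)])" by simp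
next
  show "0 \<in> path_verts n" using n by (simp add: path_verts_def)
qed (simp_all add: to_move_def)

section \<open>Short paths\<close>

lemma Union_path_edges_subset: "\<Union> (path_edges n) \<subseteq> path_verts n"
  by (auto simp: path_edges_def path_verts_def)

lemma card_path_verts: "card (path_verts n) \<le> Suc (card (path_edges n))"
  by (simp add: path_verts_def card_path_edges)

text \<open>There is at most one edge, so edge labels never clash and any free label fits any free
  vertex.\<close>

lemma wins_Alice_short:
  assumes "n = 1 \<or> n = 2"
  shows "wins (path_verts n) (path_edges n) starter Alice []"
proof (rule wins_Alice_if_always_movable)
  fix t
  assume "legal_play (path_verts n) (path_edges n) ([] @ t)" "dom (map_of ([] @ t)) \<noteq> path_verts n"
  then obtain v l where "v \<in> path_verts n" "v \<notin> dom (map_of t)" "l \<in> {0..card (path_edges n)}"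
    "l \<notin> ran (map_of t)"
    using ex_free_vertex_and_label[OF _ card_path_verts] by fastforce
  moreover have "edge_labels_distinct (path_edges n) f" for f
    by (rule edge_labels_distinct_path) (use assms in auto)
  ultimately show "\<exists>mv. legal_move (path_verts n) (path_edges n) ([] @ t) mv"
    by (auto simp: legal_move_def simp del: fun_upd_apply intro!: exI[of _ "(v, l)"])
qed (simp_all add: Union_path_edges_subset)

text \<open>With \<open>0\<close> at the center, the label of each edge equals the label of its
  outer end, so distinct vertex labels already give distinct edge labels.\<close>

lemma legal_move_if_center_zero:
  assumes play: "legal_play (path_verts 3) (path_edges 3) h" and center: "map_of h 1 = Some 0"
    and "dom (map_of h) \<noteq> path_verts 3"
  shows "\<exists>mv. legal_move (path_verts 3) (path_edges 3) h mv"
proof -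
  let ?V = "path_verts 3" and ?E = "path_edges 3"
  obtain v l where vl: "v \<in> ?V" "v \<notin> dom (map_of h)" "l \<in> {0..card ?E}" "l \<notin> ran (map_of h)"
    using ex_free_vertex_and_label[OF finite_path_verts card_path_verts play assms(3)] by blast
  have inj: "inj_on (map_of h) (dom (map_of h))" using legal_play_invariant[OF play] by blast
  have "edge_labels_distinct ?E ((map_of h)(v \<mapsto> l))"
  proof (rule edge_labels_distinct_path)
    let ?f = "(map_of h)(v \<mapsto> l)"
    fix i j a b c d
    assume ij: "i < j" "Suc j < 3" and f: "?f i = Some a" "?f (Suc i) = Some b" "?f j = Some c" "?f (Suc j) = Some d"
    have [simp]: "i = 0" "j = 1" using ij by auto
    have v: "v \<noteq> 1" using vl(2) center by auto
    then have "b = 0" "c = 0" using f center by auto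
    moreover have "a \<noteq> d"
    proof
      assume "a = d"
      then have eq: "?f 0 = Some a" "?f 2 = Some a" using f by (simp_all add: numeral_2_eq_2)
      consider "v = 0" | "v = 2" | "v \<noteq> 0" "v \<noteq> 2" by blast
      then show False
      proof cases
        case 1
        then show False using eq vl(4) ranI[of "map_of h" 2 l] by simp
      next
        case 2
        then show False using eq vl(4) ranI[of "map_of h" 0 l] by simp
      next
        case 3
        then show False using eq inj_onD[OF inj, of 0 2] by auto
      qed
    qed
    ultimately show "\<bar>int a - int b\<bar> \<noteq> \<bar>int c - int d\<bar>" by simp
  qed
  then show ?thesis
    using vl by (intro exI[of _ "(v, l)"]) (simp add: legal_move_def del: fun_upd_apply)
qed

lemma wins_Alice_first_3: "wins (path_verts 3) (path_edges 3) Alice Alice []"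
proof (rule wins_own)
  show legal: "legal_move (path_verts 3) (path_edges 3) [] (1, 0)"
    by (rule legal_move_path_no_second_edge) auto
  show "wins (path_verts 3) (path_edges 3) Alice Alice ([] @ [(1, 0)])"
  proof (rule wins_Alice_if_always_movable)
    show "legal_play (path_verts 3) (path_edges 3) ([] @ [(1, 0)])"
      using legal by (simp only: legal_play_snoc legal_play_Nil)
    show "\<exists>mv. legal_move (path_verts 3) (path_edges 3) (([] @ [(1, 0)]) @ t) mv"
      if "legal_play (path_verts 3) (path_edges 3) (([] @ [(1, 0)]) @ t)"
        "dom (map_of (([] @ [(1, 0)]) @ t)) \<noteq> path_verts 3" for t
      using that by (intro legal_move_if_center_zero) auto
  qed (simp_all add: Union_path_edges_subset)
qed (simp add: to_move_def)

text \<open>With \<open>1\<close> at the center, the ends are left with \<open>0\<close> and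
  \<open>2\<close>, and both edges would get label \<open>1\<close>.\<close>

lemma wins_Bob_first_3: "wins (path_verts 3) (path_edges 3) Bob Bob []"
proof (rule wins_own)
  show "legal_move (path_verts 3) (path_edges 3) [] (1, 1)"
    by (rule legal_move_path_no_second_edge) auto
  show "wins (path_verts 3) (path_edges 3) Bob Bob ([] @ [(1, 1)])"
  proof (rule wins_Bob_path_if_contradictory)
    fix g assume g: "graceful_path 3 g" "\<forall>(v, l)\<in>set ([] @ [(1, 1)]). g v = l"
    have "g 0 \<le> 2" "g 2 \<le> 2" "g 1 = 1" using g by (auto simp: graceful_path_def)
    moreover have "g 0 \<noteq> g 1" "g 2 \<noteq> g 1"
      using graceful_path_inj[OF g(1), of 0 1] graceful_path_inj[OF g(1), of 2 1] by auto
    ultimately have "\<bar>int (g 0) - int (g (Suc 0))\<bar> = \<bar>int (g 1) - int (g (Suc 1))\<bar>"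
      by (simp add: numeral_2_eq_2)
    then show False using graceful_path_distinct(2)[OF g(1)] by (simp add: upt_rec)
  qed simp
qed (simp add: to_move_def)

theorem theorem1:
  shows "(\<forall>n\<ge>4. \<forall>starter. has_winning_strategy (path_verts n) (path_edges n) starter Bob) \<and>
    (\<forall>starter. has_winning_strategy (path_verts 3) (path_edges 3) starter starter) \<and>
    (\<forall>n\<in>{1, 2}. \<forall>starter. has_winning_strategy (path_verts n) (path_edges n) starter Alice)"
proof (intro conjI allI ballI impI)
  fix n :: nat and starter assume "4 \<le> n"
  then show "has_winning_strategy (path_verts n) (path_edges n) starter Bob"
    using wins_Bob_first wins_Bob_second by (cases starter) (auto intro: has_winning_strategy_if_wins)
next
  fix starter show "has_winning_strategy (path_verts 3) (path_edges 3) starter starter"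
    using wins_Alice_first_3 wins_Bob_first_3 by (cases starter) (auto intro: has_winning_strategy_if_wins)
next
  fix n :: nat and starter assume "n \<in> {1, 2}"
  then show "has_winning_strategy (path_verts n) (path_edges n) starter Alice"
    using wins_Alice_short by (auto intro: has_winning_strategy_if_wins)
qed

end
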